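(* Let $v>0$ be known, and let $\Delta_n>0$ satisfy $\Delta_n\to 0$ and $n\Delta_n\to\infty$ as $n\to\infty$. Let $\lambda_0$ be the true value of the rate and let $\{X(t), t\geq 0\}$ be the telegraph process with velocity $v$ and rate $\lambda_0$, observed at the times $i\Delta_n$, $i=0,1,\ldots,n$. Let $\eta_i=X(i\Delta_n)-X((i-1)\Delta_n)$, $i=1,\ldots,n$, let $$ \tilde\lambda_n=\frac{1}{n\Delta_n}\sum_{i=1}^n\mathbf{1}_{\{|\eta_i|<v\Delta_n\}}, $$ and let $$ \hat\lambda_n=-\frac{1}{\Delta_n}\log\left(1-\Delta_n\tilde\lambda_n\right). $$ Then, for all fixed $\lambda_0>0$, the estimator $\hat\lambda_n$ is consistent, asymptotically normal and attains the minimum variance, i.e. it is asymptotically efficient: $$ \sqrt{n\Delta_n}\,(\hat\lambda_n-\lambda_0)\overset{d}{\longrightarrow}N(0,\lambda_0), $$ where $\overset{d}{\to}$ denotes convergence in distribution.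
   Context: The telegraph process with velocity $v>0$ and rate $\lambda_0>0$ is defined by $$X(t)=V(0)\int_0^t(-1)^{N(s)}\,\mathrm{d}s,\qquad t> 0,$$ with $X(0)=0$, where $\{N(t),t> 0\}$ is a homogeneous Poisson process with rate $\lambda_0$, and $V(0)$ is the initial velocity, independent of $N$, taking the values $+v$ and $-v$ with equal probability. $\mathbf{1}_A$ denotes the indicator function of the event $A$. The minimum variance meant here is the asymptotic variance $\lambda_0$ of $N(T)/T$, the optimal estimator of the rate when the process is observed continuously on $[0,T]$, with $T=n\Delta_n$ (the problem of estimating the intensity of a homogeneous Poisson process). *)

theory Defs
  imports "HOL-Probability.Probability"
begin

text \<open>
  Paths are right-continuous and nondecreasing at every sample point (not just almost surely), so
  that path functionals of \<open>N\<close> are measurable without completing \<open>M\<close>. The subtraction of counts is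
  the truncated one on \<open>nat\<close>; it is the genuine difference since paths are nondecreasing.
  Only times \<open>t \<ge> 0\<close> are constrained.
\<close>

locale poisson_process = prob_space M for M :: "'a measure" +
  fixes rate :: real and N :: "real \<Rightarrow> 'a \<Rightarrow> nat"
  assumes rate_pos: "rate > 0"
    and measurable_N: "\<And>t. 0 \<le> t \<Longrightarrow> N t \<in> measurable M (count_space UNIV)"
    and N_0: "\<And>\<omega>. \<omega> \<in> space M \<Longrightarrow> N 0 \<omega> = 0"
    and mono_N: "\<And>\<omega> s t. \<omega> \<in> space M \<Longrightarrow> 0 \<le> s \<Longrightarrow> s \<le> t \<Longrightarrow> N s \<omega> \<le> N t \<omega>"
    and right_continuous_N:
      "\<And>\<omega> t. \<omega> \<in> space M \<Longrightarrow> 0 \<le> t \<Longrightarrow> continuous (at_right t) (\<lambda>s. N s \<omega>)"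
    and independent_increments:
      "\<And>(t :: nat \<Rightarrow> real) k. 0 \<le> t 0 \<Longrightarrow> mono t \<Longrightarrow>
         indep_vars (\<lambda>_. count_space UNIV) (\<lambda>i \<omega>. N (t (Suc i)) \<omega> - N (t i) \<omega>) {..<k}"
    and poisson_increments:
      "\<And>s t. 0 \<le> s \<Longrightarrow> s < t \<Longrightarrow>
         distr M (count_space UNIV) (\<lambda>\<omega>. N t \<omega> - N s \<omega>) = measure_pmf (poisson_pmf (rate * (t - s)))"

text \<open>
  Independence of \<open>V0\<close> from \<open>N\<close> is independence from the whole process, regarded as a random
  element of the product space over all times \<open>t \<ge> 0\<close>. It is stated for the generated sigma-algebras
  because \<open>indep_var\<close> requires both random elements to have the same type.
\<close>

locale telegraph_process = poisson_process M rate N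
  for M :: "'a measure" and rate :: real and N :: "real \<Rightarrow> 'a \<Rightarrow> nat" +
  fixes v :: real and V0 :: "'a \<Rightarrow> real"
  assumes v_pos: "v > 0"
    and measurable_V0: "V0 \<in> borel_measurable M"
    and prob_V0_plus: "prob {\<omega> \<in> space M. V0 \<omega> = v} = 1 / 2"
    and prob_V0_minus: "prob {\<omega> \<in> space M. V0 \<omega> = - v} = 1 / 2"
    and indep_V0_N:
      "indep_set {V0 -` A \<inter> space M | A. A \<in> sets borel}
         {(\<lambda>\<omega>. \<lambda>t\<in>{0..}. N t \<omega>) -` B \<inter> space M | B. B \<in> sets (PiM {0..} (\<lambda>_. count_space UNIV))}"

definition telegraph :: "('a \<Rightarrow> real) \<Rightarrow> (real \<Rightarrow> 'a \<Rightarrow> nat) \<Rightarrow> real \<Rightarrow> 'a \<Rightarrow> real" where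
  "telegraph V0 N t \<omega> = V0 \<omega> * integral {0..t} (\<lambda>s. (- 1) ^ N s \<omega>)"

definition increment :: "(real \<Rightarrow> 'a \<Rightarrow> real) \<Rightarrow> real \<Rightarrow> nat \<Rightarrow> 'a \<Rightarrow> real" where
  "increment X d i \<omega> = X (real i * d) \<omega> - X ((real i - 1) * d) \<omega>"

definition lambda_tilde :: "real \<Rightarrow> (real \<Rightarrow> 'a \<Rightarrow> real) \<Rightarrow> real \<Rightarrow> nat \<Rightarrow> 'a \<Rightarrow> real" where
  "lambda_tilde v X d n \<omega> =
     1 / (real n * d) * (\<Sum>i = 1..n. indicator {\<omega>. \<bar>increment X d i \<omega>\<bar> < v * d} \<omega>)"

text \<open>
  On the event that all \<open>n\<close> indicators are \<open>1\<close> the argument of the logarithm is \<open>0\<close> and the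
  estimator is undefined as a real number; \<open>ln 0 = 0\<close> assigns it the value \<open>0\<close> there.
\<close>

definition lambda_hat :: "real \<Rightarrow> (real \<Rightarrow> 'a \<Rightarrow> real) \<Rightarrow> real \<Rightarrow> nat \<Rightarrow> 'a \<Rightarrow> real" where
  "lambda_hat v X d n \<omega> = - (1 / d) * ln (1 - d * lambda_tilde v X d n \<omega>)"

definition consistent_estimator :: "'a measure \<Rightarrow> (nat \<Rightarrow> 'a \<Rightarrow> real) \<Rightarrow> real \<Rightarrow> bool" where
  "consistent_estimator M est \<theta> \<longleftrightarrow>
     (\<forall>\<epsilon>>0. (\<lambda>n. measure M {\<omega> \<in> space M. \<bar>est n \<omega> - \<theta>\<bar> > \<epsilon>}) \<longlonglongrightarrow> 0)"

text \<open>
  \<open>T n\<close> is the length of the observation window and \<open>\<sigma>2\<close> the asymptotic variance;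
  \<open>normal_density\<close> takes the standard deviation, hence the square root.
\<close>

definition asymptotically_normal ::
    "'a measure \<Rightarrow> (nat \<Rightarrow> real) \<Rightarrow> (nat \<Rightarrow> 'a \<Rightarrow> real) \<Rightarrow> real \<Rightarrow> real \<Rightarrow> bool" where
  "asymptotically_normal M T est \<theta> \<sigma>2 \<longleftrightarrow>
     weak_conv_m (\<lambda>n. distr M borel (\<lambda>\<omega>. sqrt (T n) * (est n \<omega> - \<theta>)))
       (density lborel (normal_density 0 (sqrt \<sigma>2)))"

end

theory Submission
  imports Defs
begin

text \<open>
  Almost surely \<open>\<bar>\<eta>\<^sub>i\<bar> < v \<Delta>\<close> holds exactly when the Poisson process jumps in the \<open>i\<close>-th cell, so \<open>1 - \<Delta> \<lambda>\<close>-tilde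
  is the fraction \<open>z\<close> of cells without a jump, and with \<open>\<mu> = rate \<Delta>\<close> and \<open>U = 1 - exp \<mu> z\<close> the estimator is
  \<open>rate - ln (1 - U) / \<Delta>\<close>. Its linearisation \<open>rate + U / \<Delta>\<close> differs from \<open>N(T) / T\<close>, after multiplication by
  \<open>sqrt T\<close>, by a sum of independent centred terms with total variance \<open>(exp \<mu> - 1 - \<mu>) / \<Delta> \<rightarrow> 0\<close>, while
  the quadratic remainder is of order \<open>sqrt T U\<^sup>2 / \<Delta>\<close>, with mean \<open>(exp \<mu> - 1) / sqrt T \<rightarrow> 0\<close>. Hence by Slutsky
  the estimator inherits the limit law of \<open>N(T) / T\<close>, which Levy's continuity theorem reads off the
  Poisson characteristic function.
\<close>

section \<open>Poisson moments\<close>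

lemma has_bochner_integral_measure_pmf_nat:
  fixes g :: "nat \<Rightarrow> 'b :: {banach, second_countable_topology}"
  assumes "(\<lambda>k. pmf p k *\<^sub>R g k) sums S" and "summable (\<lambda>k. norm (pmf p k *\<^sub>R g k))"
  shows "has_bochner_integral (measure_pmf p) g S"
proof -
  have i: "integrable (count_space UNIV) (\<lambda>k. pmf p k *\<^sub>R g k)"
    using assms(2) by (simp add: integrable_count_space_nat_iff)
  then have "integral\<^sup>L (count_space UNIV) (\<lambda>k. pmf p k *\<^sub>R g k) = S"
    using sums_integral_count_space_nat assms(1) sums_unique2 by blast
  with i show ?thesis
    unfolding measure_pmf_eq_density
    by (intro has_bochner_integral_density) (auto simp: has_bochner_integral_iff pmf_nonneg)
qed

lemma has_bochner_integral_poisson_mult: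
  fixes g :: "nat \<Rightarrow> real"
  assumes "\<mu> > 0" and g: "has_bochner_integral (measure_pmf (poisson_pmf \<mu>)) (\<lambda>k. g (Suc k)) I"
  shows "has_bochner_integral (measure_pmf (poisson_pmf \<mu>)) (\<lambda>k. real k * g k) (\<mu> * I)"
proof -
  let ?p = "pmf (poisson_pmf \<mu>)"
  have i: "integrable (count_space UNIV) (\<lambda>k. ?p k *\<^sub>R g (Suc k))"
    and eq: "integral\<^sup>L (count_space UNIV) (\<lambda>k. ?p k *\<^sub>R g (Suc k)) = I"
    using g unfolding measure_pmf_eq_density has_bochner_integral_iff
    by (auto simp: integrable_density integral_density pmf_nonneg)
  have s: "(\<lambda>k. ?p k *\<^sub>R g (Suc k)) sums I"
    using sums_integral_count_space_nat[OF i] eq by simp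
  have a: "summable (\<lambda>k. norm (?p k *\<^sub>R g (Suc k)))"
    using i by (simp add: integrable_count_space_nat_iff)
  have shift: "?p (Suc k) *\<^sub>R (real (Suc k) * g (Suc k)) = \<mu> * (?p k *\<^sub>R g (Suc k))" for k
    using assms(1) by (simp add: divide_simps)
  show ?thesis
  proof (rule has_bochner_integral_measure_pmf_nat)
    have "(\<lambda>k. ?p (Suc k) *\<^sub>R (real (Suc k) * g (Suc k))) sums (\<mu> * I)"
      unfolding shift by (intro sums_mult s)
    then show "(\<lambda>k. ?p k *\<^sub>R (real k * g k)) sums (\<mu> * I)"
      by (subst (asm) sums_Suc_iff) simp
    have "summable (\<lambda>k. norm (?p (Suc k) *\<^sub>R (real (Suc k) * g (Suc k))))"
      unfolding shift norm_mult by (intro summable_mult a)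
    then show "summable (\<lambda>k. norm (?p k *\<^sub>R (real k * g k)))"
      by (subst (asm) summable_Suc_iff)
  qed
qed

lemma has_bochner_integral_poisson_mean:
  assumes "\<mu> > 0"
  shows "has_bochner_integral (measure_pmf (poisson_pmf \<mu>)) real \<mu>"
proof -
  have "has_bochner_integral (measure_pmf (poisson_pmf \<mu>)) (\<lambda>k. 1 :: real) 1"
    using measure_pmf.prob_space by (auto simp: has_bochner_integral_iff)
  from has_bochner_integral_poisson_mult[OF assms, of "\<lambda>_. 1", OF this] show ?thesis by simp
qed

lemma has_bochner_integral_poisson_second_moment:
  assumes "\<mu> > 0"
  shows "has_bochner_integral (measure_pmf (poisson_pmf \<mu>)) (\<lambda>k. (real k)\<^sup>2) (\<mu> * (\<mu> + 1))"
proof -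
  have "has_bochner_integral (measure_pmf (poisson_pmf \<mu>)) (\<lambda>k. real (Suc k)) (\<mu> + 1)"
    using has_bochner_integral_add[OF has_bochner_integral_poisson_mean[OF assms], of "\<lambda>_. 1" 1]
      measure_pmf.prob_space by (auto simp: has_bochner_integral_iff add_ac)
  from has_bochner_integral_poisson_mult[OF assms, of real, OF this] show ?thesis
    by (simp add: power2_eq_square)
qed

lemma has_bochner_integral_pmf_single:
  shows "has_bochner_integral (measure_pmf p) (\<lambda>k. of_bool (k = x) :: real) (pmf p x)"
proof -
  have "has_bochner_integral (measure_pmf p) (indicator {x} :: _ \<Rightarrow> real) (measure (measure_pmf p) {x})"
    by (rule has_bochner_integral_real_indicator) (auto simp: measure_pmf.emeasure_eq_measure)
  moreover have "(\<lambda>k. of_bool (k = x)) = indicat_real {x}"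
    by (auto simp: indicator_def)
  ultimately show ?thesis
    by (simp add: pmf.rep_eq)
qed

text \<open>The score of the event \<open>k = 0\<close>, normalised so that its covariance with \<open>k\<close> is the Poisson variance \<open>\<mu>\<close>.\<close>

definition zero_score :: "real \<Rightarrow> nat \<Rightarrow> real" where
  "zero_score \<mu> k = 1 - exp \<mu> * of_bool (k = 0)"

lemma zero_score_moments:
  assumes "\<mu> > 0"
  shows "has_bochner_integral (measure_pmf (poisson_pmf \<mu>)) (zero_score \<mu>) 0" (is ?A)
    and "has_bochner_integral (measure_pmf (poisson_pmf \<mu>)) (\<lambda>k. (zero_score \<mu> k)\<^sup>2) (exp \<mu> - 1)" (is ?B)
    and "has_bochner_integral (measure_pmf (poisson_pmf \<mu>))
           (\<lambda>k. (zero_score \<mu> k - (real k - \<mu>))\<^sup>2) (exp \<mu> - 1 - \<mu>)" (is ?C)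
    and "has_bochner_integral (measure_pmf (poisson_pmf \<mu>)) (\<lambda>k. real k - \<mu>) 0" (is ?D)
    and "has_bochner_integral (measure_pmf (poisson_pmf \<mu>)) (\<lambda>k. (real k - \<mu>)\<^sup>2) \<mu>" (is ?E)
proof -
  let ?P = "measure_pmf (poisson_pmf \<mu>)"
  have c: "has_bochner_integral ?P (\<lambda>k. c) c" for c :: real
    using measure_pmf.prob_space by (auto simp: has_bochner_integral_iff)
  note z = has_bochner_integral_pmf_single[of "poisson_pmf \<mu>" 0]
  note m = has_bochner_integral_poisson_mean[OF assms]
  note m2 = has_bochner_integral_poisson_second_moment[OF assms]
  have e: "exp \<mu> * exp (- \<mu>) = 1" by (simp add: exp_minus)
  have lin: "has_bochner_integral ?P (\<lambda>k. a + b * of_bool (k = 0) + c * real k + d * (real k)\<^sup>2)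
     (a + b * exp (- \<mu>) + c * \<mu> + d * (\<mu> * (\<mu> + 1)))" for a b c d :: real
    by (intro has_bochner_integral_add has_bochner_integral_mult_right c z[simplified] m m2)
      (use z assms in auto)
  have by_lin: "has_bochner_integral ?P f s"
    if "\<And>k. f k = a + b * of_bool (k = 0) + c * real k + d * (real k)\<^sup>2"
      "s = a + b * exp (- \<mu>) + c * \<mu> + d * (\<mu> * (\<mu> + 1))" for f :: "nat \<Rightarrow> real" and a b c d s
    using lin[of a b c d] that by presburger
  show ?A
    by (rule by_lin[of _ 1 "- exp \<mu>" 0 0]) (use e in \<open>auto simp: zero_score_def\<close>)
  show ?B
    by (rule by_lin[of _ 1 "exp \<mu> * exp \<mu> - 2 * exp \<mu>" 0 0])
      (use e in \<open>auto simp: zero_score_def power2_eq_square algebra_simps\<close>)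
  show ?C
    by (rule by_lin[of _ "(1 + \<mu>)\<^sup>2" "exp \<mu> * exp \<mu> - 2 * (1 + \<mu>) * exp \<mu>" "- 2 * (1 + \<mu>)" 1])
      (auto simp: zero_score_def power2_eq_square exp_minus field_simps)
  show ?D
    by (rule by_lin[of _ "- \<mu>" 0 1 0]) auto
  show ?E
    by (rule by_lin[of _ "\<mu> * \<mu>" 0 "- 2 * \<mu>" 1]) (auto simp: power2_eq_square algebra_simps)
qed

lemma poisson_tails:
  assumes "\<mu> > 0"
  shows "measure (measure_pmf (poisson_pmf \<mu>)) {k. k \<noteq> 0} \<le> \<mu>"
    and "measure (measure_pmf (poisson_pmf \<mu>)) {k. 2 \<le> k} \<le> \<mu>\<^sup>2"
proof -
  let ?P = "measure_pmf (poisson_pmf \<mu>)"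
  have "{k. k \<noteq> 0} = UNIV - {0 :: nat}" by auto
  then have "measure ?P {k. k \<noteq> 0} = 1 - measure ?P {0}"
    using measure_pmf.prob_compl[of "{0}" "poisson_pmf \<mu>"] by simp
  also have "\<dots> = 1 - exp (- \<mu>)" using assms by (simp add: measure_pmf_single)
  also have "\<dots> \<le> \<mu>" using exp_ge_add_one_self[of "- \<mu>"] by simp
  finally show "measure ?P {k. k \<noteq> 0} \<le> \<mu>" .
  have "{k. 2 \<le> k} = UNIV - {0, 1::nat}" by auto
  then have "measure ?P {k. 2 \<le> k} = 1 - measure ?P {0, 1}"
    using measure_pmf.prob_compl[of "{0, 1}" "poisson_pmf \<mu>"] by simp
  also have "\<dots> = 1 - (1 + \<mu>) * exp (- \<mu>)"
    using assms by (simp add: measure_measure_pmf_finite algebra_simps)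
  also have "\<dots> \<le> 1 - (1 + \<mu>) * (1 - \<mu>)"
    using exp_ge_add_one_self[of "- \<mu>"] assms by (intro diff_left_mono mult_left_mono) auto
  finally show "measure ?P {k. 2 \<le> k} \<le> \<mu>\<^sup>2" by (simp add: power2_eq_square algebra_simps)
qed

lemma has_bochner_integral_poisson_iexp:
  assumes "\<mu> > 0"
  shows "has_bochner_integral (measure_pmf (poisson_pmf \<mu>)) (\<lambda>k. iexp (s * real k))
           (exp (of_real \<mu> * (iexp s - 1)))"
proof (rule has_bochner_integral_measure_pmf_nat)
  have eq: "pmf (poisson_pmf \<mu>) k *\<^sub>R iexp (s * real k)
      = exp (- of_real \<mu>) * ((of_real \<mu> * iexp s) ^ k /\<^sub>R fact k)" for k
    using assms by (simp add: power_mult_distrib scaleR_conv_of_real exp_of_nat_mult[symmetric]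
        exp_of_real[symmetric] of_real_inverse divide_simps mult_ac)
  show "(\<lambda>k. pmf (poisson_pmf \<mu>) k *\<^sub>R iexp (s * real k)) sums exp (of_real \<mu> * (iexp s - 1))"
    unfolding eq right_diff_distrib exp_diff mult_1_right
    using sums_mult[OF exp_converges[of "of_real \<mu> * iexp s"], of "exp (- of_real \<mu>)"]
    by (simp add: exp_minus divide_simps mult_ac)
  show "summable (\<lambda>k. norm (pmf (poisson_pmf \<mu>) k *\<^sub>R iexp (s * real k)))"
    unfolding eq norm_mult by (intro summable_mult summable_norm_exp)
qed

section \<open>Convergence in probability\<close>

lemma (in prob_space) has_bochner_integral_indep_sum_square:
  fixes X :: "'i \<Rightarrow> 'a \<Rightarrow> real"
  assumes "finite I" and "indep_vars (\<lambda>_. borel) X I"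
    and "\<And>i. i \<in> I \<Longrightarrow> has_bochner_integral M (X i) 0"
    and "\<And>i. i \<in> I \<Longrightarrow> has_bochner_integral M (\<lambda>\<omega>. (X i \<omega>)\<^sup>2) (s i)"
  shows "has_bochner_integral M (\<lambda>\<omega>. (\<Sum>i\<in>I. X i \<omega>)\<^sup>2) (\<Sum>i\<in>I. s i)"
  using assms
proof (induction I rule: finite_induct)
  case empty
  then show ?case by (simp add: has_bochner_integral_zero)
next
  case (insert j I)
  let ?S = "\<lambda>\<omega>. \<Sum>i\<in>I. X i \<omega>"
  have IH: "has_bochner_integral M (\<lambda>\<omega>. (?S \<omega>)\<^sup>2) (\<Sum>i\<in>I. s i)"
    using insert.prems by (intro insert.IH indep_vars_subset[of "\<lambda>_. borel" X "insert j I" I]) auto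
  have S: "has_bochner_integral M ?S (\<Sum>i\<in>I. 0)"
    using insert.prems by (intro has_bochner_integral_sum) auto
  have X: "has_bochner_integral M (X j) 0" "has_bochner_integral M (\<lambda>\<omega>. (X j \<omega>)\<^sup>2) (s j)"
    using insert.prems by auto
  have ind: "indep_var borel (X j) borel ?S"
    using insert by (intro indep_vars_sum) auto
  have XS: "has_bochner_integral M (\<lambda>\<omega>. X j \<omega> * ?S \<omega>) 0"
    using indep_var_lebesgue_integral[OF ind] indep_var_integrable[OF ind] X S
    by (auto simp: has_bochner_integral_iff)
  have "has_bochner_integral M (\<lambda>\<omega>. (X j \<omega>)\<^sup>2 + (2 * (X j \<omega> * ?S \<omega>) + (?S \<omega>)\<^sup>2)) (s j + (2 * 0 + (\<Sum>i\<in>I. s i)))"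
    by (intro has_bochner_integral_add has_bochner_integral_mult_right X XS IH)
  then show ?case
    using insert.hyps by (simp add: power2_sum algebra_simps)
qed

text \<open>\<open>consistent_estimator M X 0\<close> serves as convergence of \<open>X\<close> to \<open>0\<close> in probability.\<close>

lemma (in prob_space) consistent_estimator_cover:
  assumes m: "\<And>n. random_variable borel (Y n)" "\<And>n. random_variable borel (Z n)"
    and Y: "consistent_estimator M Y 0" and Z: "consistent_estimator M Z 0"
    and cover: "\<And>\<epsilon>. \<epsilon> > 0 \<Longrightarrow> \<exists>a>0. \<exists>b>0. \<forall>\<^sub>F n in sequentially.
      AE \<omega> in M. \<bar>X n \<omega> - \<theta>\<bar> > \<epsilon> \<longrightarrow> \<bar>Y n \<omega>\<bar> > a \<or> \<bar>Z n \<omega>\<bar> > b"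
  shows "consistent_estimator M X \<theta>"
  unfolding consistent_estimator_def
proof (intro allI impI)
  fix \<epsilon> :: real assume "\<epsilon> > 0"
  then obtain a b where ab: "a > 0" "b > 0" and ev: "\<forall>\<^sub>F n in sequentially.
      AE \<omega> in M. \<bar>X n \<omega> - \<theta>\<bar> > \<epsilon> \<longrightarrow> \<bar>Y n \<omega>\<bar> > a \<or> \<bar>Z n \<omega>\<bar> > b"
    using cover by blast
  note [measurable] = m
  let ?A = "\<lambda>n. {\<omega>\<in>space M. \<bar>Y n \<omega>\<bar> > a}" and ?B = "\<lambda>n. {\<omega>\<in>space M. \<bar>Z n \<omega>\<bar> > b}"
  have lim: "(\<lambda>n. prob (?A n) + prob (?B n)) \<longlonglongrightarrow> 0 + 0"
    using Y Z ab unfolding consistent_estimator_def by (intro tendsto_add) auto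
  show "(\<lambda>n. prob {\<omega> \<in> space M. \<epsilon> < \<bar>X n \<omega> - \<theta>\<bar>}) \<longlonglongrightarrow> 0"
  proof (rule tendsto_sandwich[OF _ _ tendsto_const])
    show "\<forall>\<^sub>F n in sequentially. prob {\<omega> \<in> space M. \<epsilon> < \<bar>X n \<omega> - \<theta>\<bar>} \<le> prob (?A n) + prob (?B n)"
      using ev
    proof eventually_elim
      case (elim n)
      have "prob {\<omega> \<in> space M. \<epsilon> < \<bar>X n \<omega> - \<theta>\<bar>} \<le> prob (?A n \<union> ?B n)"
        using elim by (intro finite_measure_mono_AE) auto
      also have "\<dots> \<le> prob (?A n) + prob (?B n)"
        by (intro measure_Un_le) auto
      finally show ?case .
    qed
  qed (use lim in auto)
qed

lemma (in prob_space) consistent_estimator_L1: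
  assumes I: "\<And>n. integrable M (X n)" and lim: "(\<lambda>n. expectation (\<lambda>\<omega>. \<bar>X n \<omega>\<bar>)) \<longlonglongrightarrow> 0"
  shows "consistent_estimator M X 0"
  unfolding consistent_estimator_def
proof (intro allI impI)
  fix \<epsilon> :: real assume "\<epsilon> > 0"
  show "(\<lambda>n. prob {\<omega> \<in> space M. \<epsilon> < \<bar>X n \<omega> - 0\<bar>}) \<longlonglongrightarrow> 0"
  proof (rule tendsto_sandwich[OF _ _ tendsto_const])
    show "\<forall>\<^sub>F n in sequentially. prob {\<omega> \<in> space M. \<epsilon> < \<bar>X n \<omega> - 0\<bar>} \<le> expectation (\<lambda>\<omega>. \<bar>X n \<omega>\<bar>) / \<epsilon>"
    proof (intro always_eventually allI)
      fix n
      note [measurable] = borel_measurable_integrable[OF I]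
      have "prob {\<omega> \<in> space M. \<epsilon> < \<bar>X n \<omega> - 0\<bar>} \<le> prob {\<omega> \<in> space M. \<epsilon> \<le> \<bar>X n \<omega>\<bar>}"
        by (intro finite_measure_mono) auto
      also have "\<dots> \<le> expectation (\<lambda>\<omega>. \<bar>X n \<omega>\<bar>) / \<epsilon>"
        using I \<open>\<epsilon> > 0\<close> by (intro integral_Markov_inequality_measure[where A = "space M"]) auto
      finally show "prob {\<omega> \<in> space M. \<epsilon> < \<bar>X n \<omega> - 0\<bar>} \<le> expectation (\<lambda>\<omega>. \<bar>X n \<omega>\<bar>) / \<epsilon>" .
    qed
    show "(\<lambda>n. expectation (\<lambda>\<omega>. \<bar>X n \<omega>\<bar>) / \<epsilon>) \<longlonglongrightarrow> 0"
      using tendsto_divide[OF lim tendsto_const, of \<epsilon>] \<open>\<epsilon> > 0\<close> by simp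
  qed auto
qed

lemma (in prob_space) consistent_estimator_L2:
  assumes m: "\<And>n. random_variable borel (X n)"
    and I: "\<And>n. has_bochner_integral M (\<lambda>\<omega>. (X n \<omega>)\<^sup>2) (s n)" and lim: "s \<longlonglongrightarrow> 0"
  shows "consistent_estimator M X 0"
proof -
  have c: "consistent_estimator M (\<lambda>n \<omega>. (X n \<omega>)\<^sup>2) 0"
    using I lim by (intro consistent_estimator_L1) (auto simp: has_bochner_integral_iff)
  note [measurable] = m
  show ?thesis
  proof (rule consistent_estimator_cover[OF _ _ c c])
    fix \<epsilon> :: real assume "\<epsilon> > 0"
    then have "\<epsilon>\<^sup>2 > 0" and "\<epsilon>\<^sup>2 < (X n \<omega>)\<^sup>2" if "\<bar>X n \<omega>\<bar> > \<epsilon>" for n \<omega>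
      using that power_strict_mono[of \<epsilon> "\<bar>X n \<omega>\<bar>" 2] by simp_all
    then show "\<exists>a>0. \<exists>b>0. \<forall>\<^sub>F n in sequentially.
        AE \<omega> in M. \<epsilon> < \<bar>X n \<omega> - 0\<bar> \<longrightarrow> a < \<bar>(X n \<omega>)\<^sup>2\<bar> \<or> b < \<bar>(X n \<omega>)\<^sup>2\<bar>"
      using \<open>\<epsilon> > 0\<close> by (intro exI[of _ "\<epsilon>\<^sup>2"] conjI always_eventually) auto
  qed auto
qed

lemma (in prob_space) slutsky:
  assumes [measurable]: "\<And>n. random_variable borel (X n)" "\<And>n. random_variable borel (Y n)"
    and \<nu>: "real_distribution \<nu>" and X: "weak_conv_m (\<lambda>n. distr M borel (X n)) \<nu>"
    and D: "consistent_estimator M (\<lambda>n \<omega>. Y n \<omega> - X n \<omega>) 0"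
  shows "weak_conv_m (\<lambda>n. distr M borel (Y n)) \<nu>"
proof (rule levy_continuity)
  fix t :: real
  have bound: "cmod (char (distr M borel (Y n)) t - char (distr M borel (X n)) t)
      \<le> \<bar>t\<bar> * \<delta> + 2 * prob {\<omega> \<in> space M. \<bar>Y n \<omega> - X n \<omega>\<bar> > \<delta>}" if "\<delta> > 0" for n \<delta>
  proof -
    let ?B = "{\<omega> \<in> space M. \<bar>Y n \<omega> - X n \<omega>\<bar> > \<delta>}"
    have iB: "integrable M (indicat_real ?B)"
      by (rule integrable_real_indicator) (auto simp: emeasure_eq_measure)
    have i: "integrable M (\<lambda>\<omega>. iexp (t * Z \<omega>))" if "random_variable borel Z" for Z
      using that by (intro integrable_const_bound[of _ 1]) auto
    have "cmod (char (distr M borel (Y n)) t - char (distr M borel (X n)) t)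
        = cmod (expectation (\<lambda>\<omega>. iexp (t * Y n \<omega>) - iexp (t * X n \<omega>)))"
      unfolding char_def by (subst Bochner_Integration.integral_diff[OF i i]) (auto simp: integral_distr)
    also have "\<dots> \<le> expectation (\<lambda>\<omega>. cmod (iexp (t * Y n \<omega>) - iexp (t * X n \<omega>)))"
      by (rule integral_norm_bound)
    also have "\<dots> \<le> expectation (\<lambda>\<omega>. \<bar>t\<bar> * \<delta> + 2 * indicator ?B \<omega>)"
    proof (rule integral_mono)
      fix \<omega> assume \<omega>: "\<omega> \<in> space M"
      have le2: "cmod (iexp (t * Y n \<omega>) - iexp (t * X n \<omega>)) \<le> 2"
        using norm_triangle_ineq4[of "iexp (t * Y n \<omega>)" "iexp (t * X n \<omega>)"] by (simp del: of_real_mult)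
      have "iexp (t * Y n \<omega>) - iexp (t * X n \<omega>) = iexp (t * X n \<omega>) * (iexp (t * (Y n \<omega> - X n \<omega>)) - 1)"
        by (simp add: algebra_simps flip: exp_add)
      then have "cmod (iexp (t * Y n \<omega>) - iexp (t * X n \<omega>)) = cmod (iexp (t * (Y n \<omega> - X n \<omega>)) - 1)"
        by (simp add: norm_mult del: of_real_mult of_real_diff)
      also have "\<dots> \<le> \<bar>t\<bar> * \<bar>Y n \<omega> - X n \<omega>\<bar>"
        using iexp_approx1[of "t * (Y n \<omega> - X n \<omega>)" 0] by (simp add: abs_mult del: of_real_mult of_real_diff)
      finally have "cmod (iexp (t * Y n \<omega>) - iexp (t * X n \<omega>)) \<le> \<bar>t\<bar> * \<bar>Y n \<omega> - X n \<omega>\<bar>" .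
      moreover have "\<bar>t\<bar> * \<bar>Y n \<omega> - X n \<omega>\<bar> \<le> \<bar>t\<bar> * \<delta>" if "\<omega> \<notin> ?B"
        using that \<omega> by (intro mult_left_mono) auto
      moreover have "0 \<le> \<bar>t\<bar> * \<delta>" using \<open>\<delta> > 0\<close> by simp
      moreover have "indicat_real ?B \<omega> = (if \<omega> \<in> ?B then 1 else 0)"
        by (simp only: indicator_def of_bool_def)
      ultimately show "cmod (iexp (t * Y n \<omega>) - iexp (t * X n \<omega>)) \<le> \<bar>t\<bar> * \<delta> + 2 * indicator ?B \<omega>"
        using le2 by (smt (verit))
    next
      show "integrable M (\<lambda>\<omega>. cmod (iexp (t * Y n \<omega>) - iexp (t * X n \<omega>)))"
        by (intro integrable_norm Bochner_Integration.integrable_diff i) auto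
      show "integrable M (\<lambda>\<omega>. \<bar>t\<bar> * \<delta> + 2 * indicator ?B \<omega>)"
        by (intro Bochner_Integration.integrable_add integrable_const integrable_mult_right iB)
    qed
    also have "\<dots> = \<bar>t\<bar> * \<delta> + 2 * prob ?B"
      using iB by (subst Bochner_Integration.integral_add) (auto simp: prob_space)
    finally show ?thesis .
  qed
  have "(\<lambda>n. char (distr M borel (Y n)) t - char (distr M borel (X n)) t) \<longlonglongrightarrow> 0"
  proof (rule LIMSEQ_I)
    fix r :: real assume "r > 0"
    define \<delta> where "\<delta> = r / (2 * (\<bar>t\<bar> + 1))"
    have \<delta>: "\<delta> > 0" "\<bar>t\<bar> * \<delta> < r / 2"
      using \<open>r > 0\<close> by (auto simp: \<delta>_def divide_simps)
    have "(\<lambda>n. prob {\<omega> \<in> space M. \<bar>Y n \<omega> - X n \<omega>\<bar> > \<delta>}) \<longlonglongrightarrow> 0"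
      using D \<delta>(1) by (auto simp: consistent_estimator_def)
    then have "\<forall>\<^sub>F n in sequentially. prob {\<omega> \<in> space M. \<bar>Y n \<omega> - X n \<omega>\<bar> > \<delta>} < r / 4"
      using \<open>r > 0\<close> by (intro order_tendstoD) auto
    then have "\<forall>\<^sub>F n in sequentially.
        norm (char (distr M borel (Y n)) t - char (distr M borel (X n)) t - 0) < r"
    proof eventually_elim
      case (elim n)
      show ?case using bound[OF \<delta>(1), of n] \<delta>(2) elim unfolding diff_zero by linarith
    qed
    then show "\<exists>no. \<forall>n\<ge>no. norm (char (distr M borel (Y n)) t - char (distr M borel (X n)) t - 0) < r"
      by (simp add: eventually_sequentially)
  qed
  moreover have "(\<lambda>n. char (distr M borel (X n)) t) \<longlonglongrightarrow> char \<nu> t"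
    using \<nu> X by (intro levy_continuity1) auto
  ultimately show "(\<lambda>n. char (distr M borel (Y n)) t) \<longlonglongrightarrow> char \<nu> t"
    using tendsto_add by fastforce
qed (use \<nu> in auto)

section \<open>Increments of the Poisson process\<close>

context poisson_process
begin

lemma measurable_increment [measurable]:
  assumes "0 \<le> s" "s \<le> t"
  shows "(\<lambda>\<omega>. N t \<omega> - N s \<omega>) \<in> measurable M (count_space UNIV)"
proof -
  have [measurable]: "N s \<in> measurable M (count_space UNIV)" "N t \<in> measurable M (count_space UNIV)"
    using assms by (auto intro: measurable_N)
  show ?thesis by measurable
qed

lemma has_bochner_integral_increment:
  fixes h :: "nat \<Rightarrow> 'b :: {banach, second_countable_topology}"
  assumes "0 \<le> s" "s < t"
    and "has_bochner_integral (measure_pmf (poisson_pmf (rate * (t - s)))) h I"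
  shows "has_bochner_integral M (\<lambda>\<omega>. h (N t \<omega> - N s \<omega>)) I"
  using assms(3) measurable_increment[of s t] assms(1,2)
  unfolding poisson_increments[OF assms(1,2), symmetric] has_bochner_integral_iff
  by (simp add: integrable_distr_eq integral_distr)

lemma prob_increment:
  assumes "0 \<le> s" "s < t"
  shows "prob {\<omega> \<in> space M. N t \<omega> - N s \<omega> \<in> A}
    = measure (measure_pmf (poisson_pmf (rate * (t - s)))) A"
  using measurable_increment[of s t] assms
  unfolding poisson_increments[OF assms, symmetric]
  by (subst measure_distr) (auto intro!: arg_cong[where f = prob])

lemma has_bochner_integral_sum_increments_square:
  fixes h :: "nat \<Rightarrow> real"
  assumes "d > 0"
    and "has_bochner_integral (measure_pmf (poisson_pmf (rate * d))) h 0"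
    and "has_bochner_integral (measure_pmf (poisson_pmf (rate * d))) (\<lambda>k. (h k)\<^sup>2) s"
  shows "has_bochner_integral M
    (\<lambda>\<omega>. (\<Sum>i<n. h (N (real (Suc i) * d) \<omega> - N (real i * d) \<omega>))\<^sup>2) (real n * s)"
proof -
  let ?t = "\<lambda>i. real i * d"
  have "indep_vars (\<lambda>_. count_space UNIV) (\<lambda>i \<omega>. N (?t (Suc i)) \<omega> - N (?t i) \<omega>) {..<n}"
    using assms(1) by (intro independent_increments) (auto simp: mono_def mult_right_mono)
  then have "indep_vars (\<lambda>_. borel) (\<lambda>i \<omega>. h (N (?t (Suc i)) \<omega> - N (?t i) \<omega>)) {..<n}"
    by (rule indep_vars_compose2) auto
  moreover have "?t (Suc i) - ?t i = d" for i by (simp add: algebra_simps)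
  ultimately have "has_bochner_integral M
    (\<lambda>\<omega>. (\<Sum>i<n. h (N (?t (Suc i)) \<omega> - N (?t i) \<omega>))\<^sup>2) (\<Sum>i<n. s)"
    using assms
    by (intro has_bochner_integral_indep_sum_square has_bochner_integral_increment
        has_bochner_integral_increment[where h = "\<lambda>k. (h k)\<^sup>2"]) auto
  then show ?thesis by simp
qed

lemma count_eq_sum_increments:
  assumes "\<omega> \<in> space M" "d > 0"
  shows "real (N (real n * d) \<omega>) = (\<Sum>i<n. real (N (real (Suc i) * d) \<omega> - N (real i * d) \<omega>))"
proof -
  have "real (N (real (Suc i) * d) \<omega> - N (real i * d) \<omega>) = real (N (real (Suc i) * d) \<omega>) - real (N (real i * d) \<omega>)" for i
    using assms by (intro of_nat_diff mono_N) (auto intro: mult_right_mono)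
  then show ?thesis
    using assms by (simp add: sum_lessThan_telescope[of "\<lambda>i. real (N (real i * d) \<omega>)"] N_0 del: of_nat_Suc)
qed

lemma char_count:
  assumes "T > 0"
  shows "expectation (\<lambda>\<omega>. iexp (s * real (N T \<omega>))) = exp (of_real (rate * T) * (iexp s - 1))"
proof -
  have "has_bochner_integral M (\<lambda>\<omega>. iexp (s * real (N T \<omega> - N 0 \<omega>))) (exp (of_real (rate * T) * (iexp s - 1)))"
    using assms rate_pos has_bochner_integral_poisson_iexp[of "rate * T" s]
    by (intro has_bochner_integral_increment[where h = "\<lambda>k. iexp (s * real k)"]) auto
  then show ?thesis
    by (auto simp: has_bochner_integral_iff N_0 cong: Bochner_Integration.integral_cong)
qed

lemma asymptotically_normal_count:
  fixes T :: "nat \<Rightarrow> real"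
  assumes T: "\<And>n. 0 \<le> T n" "filterlim T at_top sequentially"
  shows "asymptotically_normal M T (\<lambda>n \<omega>. real (N (T n) \<omega>) / T n) rate rate"
  unfolding asymptotically_normal_def
proof (rule levy_continuity)
  have m: "(\<lambda>\<omega>. real (N (T n) \<omega>)) \<in> borel_measurable M" for n
    using measurable_N[of "T n"] T by measurable
  note [measurable] = m
  show "real_distribution (distr M borel (\<lambda>\<omega>. sqrt (T n) * (real (N (T n) \<omega>) / T n - rate)))" for n
    by auto
  have sr: "sqrt rate > 0" using rate_pos by simp
  have dens: "density lborel (normal_density 0 (sqrt rate)) = distr std_normal_distribution borel (\<lambda>x. sqrt rate * x)"
  proof -
    interpret S: prob_space std_normal_distribution by (rule prob_space_normal_density) simp
    have "distributed std_normal_distribution lborel (\<lambda>x. x) std_normal_density"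
      by (auto simp: distributed_def distr_id2)
    from S.normal_density_affine[OF this, of "sqrt rate" 0] rate_pos
    have "density lborel (normal_density 0 (sqrt rate)) = distr std_normal_distribution lborel (\<lambda>x. sqrt rate * x)"
      by (simp add: distributed_def)
    also have "\<dots> = distr std_normal_distribution borel (\<lambda>x. sqrt rate * x)"
      by (rule distr_cong) auto
    finally show ?thesis .
  qed
  show "real_distribution (density lborel (normal_density 0 (sqrt rate)))"
    using prob_space_normal_density[OF sr] by (auto simp: real_distribution_def real_distribution_axioms_def)
  fix t :: real
  have char_normal: "char (density lborel (normal_density 0 (sqrt rate))) t = exp (- of_real (rate * t\<^sup>2 / 2))"
  proof -
    have "char (density lborel (normal_density 0 (sqrt rate))) t = char std_normal_distribution (t * sqrt rate)"
      unfolding dens char_def by (subst integral_distr) (auto simp: mult_ac)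
    then show ?thesis
      using rate_pos by (simp add: char_std_normal_distribution power_mult_distrib mult_ac exp_of_real flip: of_real_minus of_real_mult of_real_divide of_real_power)
  qed
  define s where "s n = t / sqrt (T n)" for n
  define R where "R x = iexp x - 1 - \<i> * x + of_real (x\<^sup>2 / 2)" for x
  have ev: "\<forall>\<^sub>F n in sequentially. T n > 0"
    using T(2) by (simp add: filterlim_at_top_dense)
  have eq: "\<forall>\<^sub>F n in sequentially. exp (of_real (rate * T n) * R (s n) - of_real (rate * t\<^sup>2 / 2))
     = char (distr M borel (\<lambda>\<omega>. sqrt (T n) * (real (N (T n) \<omega>) / T n - rate))) t"
    using ev
  proof eventually_elim
    case (elim n)
    have a: "t * (sqrt (T n) * (x / T n - rate)) = s n * x + - rate * T n * s n" for x
      using elim real_sqrt_mult_self[of "T n"] by (simp add: s_def field_simps)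
    have b: "iexp (t * (sqrt (T n) * (x / T n - rate))) = iexp (s n * x) * iexp (- rate * T n * s n)" for x
      unfolding a of_real_add distrib_left exp_add ..
    have "char (distr M borel (\<lambda>\<omega>. sqrt (T n) * (real (N (T n) \<omega>) / T n - rate))) t
      = expectation (\<lambda>\<omega>. iexp (t * (sqrt (T n) * (real (N (T n) \<omega>) / T n - rate))))"
      unfolding char_def by (subst integral_distr) auto
    also have "\<dots> = expectation (\<lambda>\<omega>. iexp (s n * real (N (T n) \<omega>)) * iexp (- rate * T n * s n))"
      by (simp only: b)
    also have "\<dots> = exp (of_real (rate * T n) * (iexp (s n) - 1)) * iexp (- rate * T n * s n)"
      using char_count[OF elim, of "s n"] by simp
    also have "\<dots> = exp (of_real (rate * T n) * R (s n) - of_real (rate * (T n * (s n)\<^sup>2) / 2))"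
      unfolding exp_add[symmetric] R_def by (rule arg_cong[where f = exp]) (simp add: algebra_simps)
    also have "T n * (s n)\<^sup>2 = t\<^sup>2"
      using elim by (simp add: s_def power_divide)
    finally show ?case ..
  qed
  have "(\<lambda>n. of_real (rate * T n) * R (s n)) \<longlonglongrightarrow> 0"
  proof (rule Lim_null_comparison)
    show "\<forall>\<^sub>F n in sequentially. norm (of_real (rate * T n) * R (s n)) \<le> rate * \<bar>t\<bar> ^ 3 / 6 * inverse (sqrt (T n))"
      using ev
    proof eventually_elim
      case (elim n)
      have "R (s n) = iexp (s n) - (\<Sum>k\<le>2. (\<i> * s n) ^ k / fact k)"
        by (simp add: R_def numeral_2_eq_2 power_mult_distrib) 
      then have "cmod (R (s n)) \<le> \<bar>s n\<bar> ^ 3 / 6"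
        using iexp_approx1[of "s n" 2] by (simp add: numeral_3_eq_3 numeral_2_eq_2)
      then have "norm (of_real (rate * T n) * R (s n)) \<le> (rate * T n) * (\<bar>s n\<bar> ^ 3 / 6)"
        using rate_pos elim by (simp add: norm_mult mult_left_mono)
      also have "\<dots> = rate / 6 * (T n * \<bar>s n\<bar> ^ 3)" by simp
      also have "T n * \<bar>s n\<bar> ^ 3 = \<bar>t\<bar> ^ 3 * inverse (sqrt (T n))"
        using elim real_sqrt_mult_self[of "T n"]
        by (simp add: s_def power_divide field_simps power3_eq_cube)
      finally show ?case by (simp add: mult_ac)
    qed
    show "(\<lambda>n. rate * \<bar>t\<bar> ^ 3 / 6 * inverse (sqrt (T n))) \<longlonglongrightarrow> 0"
      by (intro tendsto_mult_right_zero tendsto_inverse_0_at_top filterlim_compose[OF sqrt_at_top T(2)])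
  qed
  then have "(\<lambda>n. exp (of_real (rate * T n) * R (s n) - of_real (rate * t\<^sup>2 / 2))) \<longlonglongrightarrow> exp (0 - of_real (rate * t\<^sup>2 / 2))"
    by (intro tendsto_intros)
  from tendsto_cong[OF eq, THEN iffD1, OF this]
  show "(\<lambda>n. char (distr M borel (\<lambda>\<omega>. sqrt (T n) * (real (N (T n) \<omega>) / T n - rate))) t)
     \<longlonglongrightarrow> char (density lborel (normal_density 0 (sqrt rate))) t"
    by (simp add: char_normal)
qed

end

section \<open>The signed path\<close>

lemma integral_less_if_right_value_less:
  fixes f :: "real \<Rightarrow> real"
  assumes f: "f integrable_on {a..b}" and le: "\<And>x. x \<in> {a..b} \<Longrightarrow> f x \<le> c"
    and p: "a \<le> p" "p < b" and ev: "\<forall>\<^sub>F x in at_right p. f x \<le> c'" and c': "c' < c"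
  shows "integral {a..b} f < c * (b - a)"
proof -
  obtain q where q: "q > p" "\<And>x. p < x \<Longrightarrow> x < q \<Longrightarrow> f x \<le> c'"
    using ev unfolding eventually_at_right_field by blast
  define l u where "l = p + (min q b - p) / 3" and "u = p + 2 * (min q b - p) / 3"
  have lu: "p < l" "l < u" "u < q" "u < b"
    using q(1) p unfolding l_def u_def by (auto simp: field_simps min_def)
  have g: "(\<lambda>x. c - f x) integrable_on {a..b}"
    using f by (intro integrable_diff integrable_const_ivl)
  then have g': "(\<lambda>x. c - f x) integrable_on {l..u}"
    by (rule integrable_subinterval_real) (use lu p in auto)
  have "0 < (c - c') * (u - l)" using lu c' by simp
  also have "\<dots> = integral {l..u} (\<lambda>x. c - c')" using lu by simp
  also have "\<dots> \<le> integral {l..u} (\<lambda>x. c - f x)"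
    using q(2) lu by (intro integral_le g' integrable_const_ivl diff_left_mono) auto
  also have "\<dots> \<le> integral {a..b} (\<lambda>x. c - f x)"
    using le lu p by (intro integral_subset_le g g') auto
  also have "\<dots> = c * (b - a) - integral {a..b} f"
    using f p by (subst integral_diff) auto
  finally show ?thesis by simp
qed

context poisson_process
begin

definition signed_count :: "real \<Rightarrow> 'a \<Rightarrow> real" where
  "signed_count s \<omega> = (- 1) ^ N s \<omega>"

lemma abs_signed_count [simp]: "\<bar>signed_count s \<omega>\<bar> = 1"
  by (simp add: signed_count_def power_abs)

lemma eventually_count_at_right:
  assumes "\<omega> \<in> space M" "0 \<le> t"
  shows "\<forall>\<^sub>F s in at_right t. N s \<omega> = N t \<omega>"
proof -
  have "((\<lambda>s. N s \<omega>) \<longlongrightarrow> N t \<omega>) (at_right t)"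
    using right_continuous_N[OF assms] by (simp add: continuous_within)
  then show ?thesis
    by (simp add: tendsto_discrete)
qed

lemma measurable_signed_count:
  "(\<lambda>(\<omega>, s). signed_count (max 0 s) \<omega>) \<in> borel_measurable (M \<Otimes>\<^sub>M lborel)"
proof -
  define r where "r k s = real_of_int \<lceil>max 0 s * real (Suc k)\<rceil> / real (Suc k)" for k s
  have r_ge: "max 0 s \<le> r k s" for k s
    unfolding r_def by (subst pos_le_divide_eq) (auto simp del: of_nat_Suc)
  have r_le: "r k s \<le> max 0 s + 1 / real (Suc k)" for k s
  proof -
    have "of_int \<lceil>max 0 s * real (Suc k)\<rceil> \<le> max 0 s * real (Suc k) + 1"
      by linarith
    then show ?thesis
      by (simp add: r_def divide_simps del: of_nat_Suc)
  qed
  show ?thesis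
  proof (rule borel_measurable_LIMSEQ_real)
    show "(\<lambda>k. (\<lambda>(\<omega>, s). signed_count (r k s) \<omega>) z) \<longlonglongrightarrow> (\<lambda>(\<omega>, s). signed_count (max 0 s) \<omega>) z"
      if "z \<in> space (M \<Otimes>\<^sub>M lborel)" for z
    proof -
      obtain \<omega> s where z: "z = (\<omega>, s)" "\<omega> \<in> space M"
        using \<open>z \<in> _\<close> by (auto simp: space_pair_measure)
      have "(\<lambda>k. max 0 s + 1 / real (Suc k)) \<longlonglongrightarrow> max 0 s + 0"
        by (intro tendsto_add tendsto_const LIMSEQ_inverse_real_of_nat[unfolded inverse_eq_divide])
      then have "(\<lambda>k. max 0 s + 1 / real (Suc k)) \<longlonglongrightarrow> max 0 s" by simp
      then have lim: "(\<lambda>k. r k s) \<longlonglongrightarrow> max 0 s"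
        by (rule tendsto_sandwich[where f = "\<lambda>_. max 0 s", rotated 3])
          (use r_ge r_le in \<open>auto intro!: always_eventually simp del: of_nat_Suc\<close>)
      obtain q where q: "q > max 0 s" "\<And>x. max 0 s < x \<Longrightarrow> x < q \<Longrightarrow> N x \<omega> = N (max 0 s) \<omega>"
        using eventually_count_at_right[OF z(2), of "max 0 s"]
        unfolding eventually_at_right_field by fastforce
      have "\<forall>\<^sub>F k in sequentially. r k s < q"
        using order_tendstoD(2)[OF lim q(1)] .
      then have "\<forall>\<^sub>F k in sequentially. signed_count (r k s) \<omega> = signed_count (max 0 s) \<omega>"
      proof eventually_elim
        case (elim k)
        then have "N (r k s) \<omega> = N (max 0 s) \<omega>"
          using r_ge[of s k] q(2)[of "r k s"] by (metis order_le_less)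
        then show ?case by (simp only: signed_count_def)
      qed
      then show ?thesis
        unfolding z prod.case by (rule tendsto_eventually)
    qed
    fix k
    have "(\<lambda>z. signed_count (real i / real (Suc k)) (fst z)) \<in> borel_measurable (M \<Otimes>\<^sub>M lborel)" for i
    proof -
      have [measurable]: "N (real i / real (Suc k)) \<in> measurable M (count_space UNIV)"
        by (intro measurable_N) simp
      show ?thesis unfolding signed_count_def by measurable
    qed
    from measurable_compose_countable[OF this, of "\<lambda>z. nat \<lceil>max 0 (snd z) * real (Suc k)\<rceil>"]
    have "(\<lambda>z. signed_count (real (nat \<lceil>max 0 (snd z) * real (Suc k)\<rceil>) / real (Suc k)) (fst z))
        \<in> borel_measurable (M \<Otimes>\<^sub>M lborel)"
      by measurable
    then show "(\<lambda>(\<omega>, s). signed_count (r k s) \<omega>) \<in> borel_measurable (M \<Otimes>\<^sub>M lborel)"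
      by (simp add: case_prod_beta' r_def)
  qed
qed

lemma signed_count_integrable_on:
  assumes "\<omega> \<in> space M" "0 \<le> a"
  shows "(\<lambda>s. signed_count s \<omega>) integrable_on {a..b}"
    and "integral {a..b} (\<lambda>s. signed_count s \<omega>)
      = (LINT s|lborel. indicator {a..b} s * signed_count (max 0 s) \<omega>)"
proof -
  have [measurable]: "(\<lambda>s. signed_count (max 0 s) \<omega>) \<in> borel_measurable lborel"
    using measurable_compose[OF measurable_Pair1'[OF assms(1)] measurable_signed_count] by simp
  have I: "set_integrable lborel {a..b} (\<lambda>s. signed_count (max 0 s) \<omega>)"
    unfolding set_integrable_def
    by (rule integrableI_bounded_set_indicator[where B = 1]) (auto simp: emeasure_lborel_Icc_eq)
  have eq: "signed_count (max 0 s) \<omega> = signed_count s \<omega>" if "s \<in> {a..b}" for s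
    using that assms(2) by (simp add: max_def)
  show "(\<lambda>s. signed_count s \<omega>) integrable_on {a..b}"
    by (rule iffD1[OF integrable_cong[OF eq] set_borel_integral_eq_integral(1)[OF I]])
  show "integral {a..b} (\<lambda>s. signed_count s \<omega>)
      = (LINT s|lborel. indicator {a..b} s * signed_count (max 0 s) \<omega>)"
    using set_borel_integral_eq_integral(2)[OF I] integral_cong[of "{a..b}", OF eq]
    unfolding set_lebesgue_integral_def by simp
qed

lemma measurable_integral_signed_count:
  assumes "0 \<le> a"
  shows "(\<lambda>\<omega>. integral {a..b} (\<lambda>s. signed_count s \<omega>)) \<in> borel_measurable M"
proof -
  have "(\<lambda>\<omega>. LINT s|lborel. indicator {a..b} s * signed_count (max 0 s) \<omega>) \<in> borel_measurable M"
    using measurable_signed_count by (intro lborel.borel_measurable_lebesgue_integral) (simp add: case_prod_beta')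
  then show ?thesis
    using signed_count_integrable_on(2) assms by (simp cong: measurable_cong)
qed

lemma abs_integral_signed_count_eq:
  assumes "\<omega> \<in> space M" "0 \<le> a" "a < b" "N b \<omega> = N a \<omega>"
  shows "\<bar>integral {a..b} (\<lambda>s. signed_count s \<omega>)\<bar> = b - a"
proof -
  have N_eq: "N s \<omega> = N a \<omega>" if "s \<in> {a..b}" for s
    using mono_N[of \<omega> a s] mono_N[of \<omega> s b] that assms by simp
  have "integral {a..b} (\<lambda>s. signed_count s \<omega>) = integral {a..b} (\<lambda>s. signed_count a \<omega>)"
    unfolding signed_count_def by (rule integral_cong) (simp only: N_eq)
  then show ?thesis
    using assms by (simp add: abs_mult)
qed

lemma abs_integral_signed_count_less:
  assumes \<omega>: "\<omega> \<in> space M" and "0 \<le> a" and p: "p \<in> {a..<b}" and q: "q \<in> {a..<b}"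
    and "signed_count p \<omega> \<noteq> signed_count q \<omega>"
  shows "\<bar>integral {a..b} (\<lambda>s. signed_count s \<omega>)\<bar> < b - a"
proof -
  let ?f = "\<lambda>s. signed_count s \<omega>"
  have one: "integral {a..b} (\<lambda>s. c * ?f s) < 1 * (b - a)"
    if "r \<in> {a..<b}" "c * ?f r = - 1" "\<bar>c\<bar> = 1" for c r
  proof (rule integral_less_if_right_value_less[where c' = "- 1" and p = r])
    show "(\<lambda>s. c * ?f s) integrable_on {a..b}"
      by (rule integrable_on_mult_right[OF signed_count_integrable_on(1)[OF \<omega> \<open>0 \<le> a\<close>]])
    show "\<forall>\<^sub>F x in at_right r. c * ?f x \<le> - 1"
      using eventually_count_at_right[OF \<omega>, of r] that \<open>0 \<le> a\<close>
      by (auto simp: signed_count_def elim: eventually_mono)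
    show "c * ?f x \<le> 1" for x
      using that(3) abs_ge_self[of "c * ?f x"] by (simp add: abs_mult)
  qed (use that in auto)
  have "?f p = 1 \<and> ?f q = - 1 \<or> ?f p = - 1 \<and> ?f q = 1"
    using assms(5) abs_signed_count[of p \<omega>] abs_signed_count[of q \<omega>] by (auto simp: abs_if split: if_splits)
  then have "\<exists>r\<in>{a..<b}. 1 * ?f r = - 1" "\<exists>r\<in>{a..<b}. - 1 * ?f r = - 1"
    using p q by auto
  then have "integral {a..b} (\<lambda>s. 1 * ?f s) < 1 * (b - a)" "integral {a..b} (\<lambda>s. - 1 * ?f s) < 1 * (b - a)"
    using one[of _ 1] one[of _ "- 1"] by auto
  then show ?thesis by (simp add: abs_less_iff)
qed

end

context poisson_process
begin

text \<open>
  The parity of \<open>N\<close> misses double jumps and a jump at \<open>b\<close>. Both are null: on a grid of \<open>m\<close> cells of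
  length \<open>h\<close> they force an increment of at least 2 in some cell or a nonzero one in the last cell,
  which has probability at most \<open>m (rate h)\<^sup>2 + rate h = O(1/m)\<close>.
\<close>

lemma AE_signed_count_changes:
  assumes a: "0 \<le> a" and ab: "a < b"
  shows "AE \<omega> in M. N b \<omega> \<noteq> N a \<omega> \<longrightarrow>
    (\<exists>p\<in>{a..<b}. \<exists>q\<in>{a..<b}. signed_count p \<omega> \<noteq> signed_count q \<omega>)"
proof -
  define h where "h j = (b - a) / real (Suc j)" for j
  define t where "t j k = a + real k * h j" for j k :: nat
  define A where "A j k = {\<omega> \<in> space M. N (t j (Suc k)) \<omega> - N (t j k) \<omega> \<in> {l. 2 \<le> l}}" for j k
  define L where "L j = {\<omega> \<in> space M. N (t j (Suc j)) \<omega> - N (t j j) \<omega> \<in> {l. l \<noteq> 0}}" for j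
  have h: "h j > 0" for j using ab by (simp add: h_def)
  have t_nonneg: "0 \<le> t j k" for j k using a h[of j] by (simp add: t_def)
  have t_less: "t j k < t j (Suc k)" for j k using h[of j] by (simp add: t_def algebra_simps)
  have t_diff: "t j (Suc k) - t j k = h j" for j k by (simp add: t_def algebra_simps)
  have t_0: "t j 0 = a" and t_last: "t j (Suc j) = b" for j
    by (simp_all add: t_def h_def del: of_nat_Suc)
  have sets: "A j k \<in> events" "L j \<in> events" for j k
    using measurable_sets[OF measurable_increment[OF t_nonneg less_imp_le[OF t_less]], of "{l. 2 \<le> l}" j k]
      measurable_sets[OF measurable_increment[OF t_nonneg less_imp_le[OF t_less]], of "{l. l \<noteq> 0}" j j]
    by (auto simp: A_def L_def vimage_def Int_def conj_commute)
  define G where "G j = (\<Union>k<Suc j. A j k) \<union> L j" for j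
  have G_sets: "G j \<in> events" for j using sets by (auto simp: G_def)
  let ?c = "rate * (b - a)"
  have G_le: "prob (G j) \<le> (?c\<^sup>2 + ?c) / real (Suc j)" for j
  proof -
    have \<mu>: "rate * h j > 0" using h rate_pos by simp
    have "prob (A j k) \<le> (rate * h j)\<^sup>2" for k
      unfolding A_def prob_increment[OF t_nonneg t_less] t_diff by (rule poisson_tails[OF \<mu>])
    then have "(\<Sum>k<Suc j. prob (A j k)) \<le> (\<Sum>k<Suc j. (rate * h j)\<^sup>2)"
      by (intro sum_mono)
    moreover have "prob (\<Union>k<Suc j. A j k) \<le> (\<Sum>k<Suc j. prob (A j k))"
      using sets by (intro measure_UNION_le) auto
    moreover have "prob (L j) \<le> rate * h j"
      unfolding L_def prob_increment[OF t_nonneg t_less] t_diff by (rule poisson_tails[OF \<mu>])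
    moreover have "prob (G j) \<le> prob (\<Union>k<Suc j. A j k) + prob (L j)"
      unfolding G_def using sets by (intro measure_Un_le) auto
    ultimately have "prob (G j) \<le> real (Suc j) * (rate * h j)\<^sup>2 + rate * h j"
      by simp
    also have "\<dots> = (?c\<^sup>2 + ?c) / real (Suc j)"
      by (simp add: h_def field_simps power2_eq_square del: of_nat_Suc)
    finally show ?thesis .
  qed
  have "(\<lambda>j. (?c\<^sup>2 + ?c) / real (Suc j)) \<longlonglongrightarrow> 0"
    using tendsto_mult_right_zero[OF LIMSEQ_inverse_real_of_nat, of "?c\<^sup>2 + ?c"] by (simp add: divide_inverse)
  moreover have "prob (\<Inter>j. G j) \<le> (?c\<^sup>2 + ?c) / real (Suc j)" for j
    using G_sets by (intro order_trans[OF finite_measure_mono G_le]) auto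
  ultimately have "prob (\<Inter>j. G j) \<le> 0"
    by (intro LIMSEQ_le_const) auto
  then have null: "(\<Inter>j. G j) \<in> null_sets M"
    using G_sets measure_nonneg[of M "\<Inter>j. G j"]
    by (auto simp: null_sets_def emeasure_eq_measure intro!: sets.countable_INT antisym)
  show ?thesis
  proof (rule AE_mp[OF AE_not_in[OF null]], intro AE_I2 impI, rule ccontr)
    fix \<omega> assume \<omega>: "\<omega> \<in> space M" and "\<omega> \<notin> (\<Inter>j. G j)" and ne: "N b \<omega> \<noteq> N a \<omega>"
      and not_ex: "\<not> (\<exists>p\<in>{a..<b}. \<exists>q\<in>{a..<b}. signed_count p \<omega> \<noteq> signed_count q \<omega>)"
    then obtain j where j: "\<omega> \<notin> G j" by auto
    have t_less_b: "t j k < b" if "k \<le> j" for k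
      using lift_Suc_mono_less[of "t j" k "Suc j", OF t_less] that by (simp add: t_last)
    have t_mono: "t j 0 \<le> t j k" for k
      using lift_Suc_mono_le[of "t j" 0 k] t_less by (simp add: less_imp_le)
    have "N (t j k) \<omega> = N a \<omega>" if "k \<le> j" for k
      using that
    proof (induction k)
      case (Suc k)
      have "t j k \<in> {a..<b}" "t j (Suc k) \<in> {a..<b}"
        using t_less_b[of k] t_less_b[of "Suc k"] t_mono[of k] t_mono[of "Suc k"] Suc.prems
        by (simp_all add: t_0)
      then have "signed_count (t j (Suc k)) \<omega> = signed_count (t j k) \<omega>"
        using not_ex by blast
      then have "even (N (t j (Suc k)) \<omega>) = even (N (t j k) \<omega>)"
        by (auto simp: signed_count_def minus_one_power_iff split: if_splits)
      moreover have "N (t j (Suc k)) \<omega> - N (t j k) \<omega> < 2"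
      proof -
        have "\<omega> \<notin> A j k" using j Suc.prems by (simp add: G_def)
        then show ?thesis using \<omega> by (simp add: A_def)
      qed
      moreover have "N (t j k) \<omega> \<le> N (t j (Suc k)) \<omega>"
        using \<omega> t_nonneg t_less by (intro mono_N) (auto intro: less_imp_le)
      ultimately have "N (t j (Suc k)) \<omega> = N (t j k) \<omega>" by presburger
      with Suc show ?case by simp
    qed (simp add: t_0)
    moreover have "N (t j (Suc j)) \<omega> - N (t j j) \<omega> = 0"
      using j \<omega> by (auto simp: G_def L_def)
    moreover have "N a \<omega> \<le> N b \<omega>"
      using \<omega> a ab by (intro mono_N) auto
    ultimately show False using ne by (simp add: t_last)
  qed
qed

end

context telegraph_process
begin

lemma AE_abs_V0: "AE \<omega> in M. \<bar>V0 \<omega>\<bar> = v"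
proof -
  note [measurable] = measurable_V0
  have "prob ({\<omega> \<in> space M. V0 \<omega> = v} \<union> {\<omega> \<in> space M. V0 \<omega> = - v}) = 1"
    using v_pos by (subst finite_measure_Union) (auto simp: prob_V0_plus prob_V0_minus)
  from AE_prob_1[OF this] show ?thesis
    using v_pos by (auto elim!: eventually_mono)
qed

lemma telegraph_eq: "telegraph V0 N t \<omega> = V0 \<omega> * integral {0..t} (\<lambda>s. signed_count s \<omega>)"
  by (simp add: telegraph_def signed_count_def)

lemma measurable_telegraph: "telegraph V0 N t \<in> borel_measurable M"
  using measurable_integral_signed_count[of 0 t] measurable_V0 by (simp add: telegraph_eq[abs_def])

lemma increment_telegraph:
  assumes "\<omega> \<in> space M" "d > 0"
  shows "increment (telegraph V0 N) d (Suc i) \<omega>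
    = V0 \<omega> * integral {real i * d..real (Suc i) * d} (\<lambda>s. signed_count s \<omega>)"
proof -
  have "integral {0..real i * d} (\<lambda>s. signed_count s \<omega>)
      + integral {real i * d..real (Suc i) * d} (\<lambda>s. signed_count s \<omega>)
      = integral {0..real (Suc i) * d} (\<lambda>s. signed_count s \<omega>)"
    using assms signed_count_integrable_on(1)[of \<omega> 0]
    by (intro Henstock_Kurzweil_Integration.integral_combine) (auto intro: mult_right_mono)
  then have "integral {0..real (Suc i) * d} (\<lambda>s. signed_count s \<omega>) - integral {0..real i * d} (\<lambda>s. signed_count s \<omega>)
    = integral {real i * d..real (Suc i) * d} (\<lambda>s. signed_count s \<omega>)" by simp
  moreover have "real (Suc i) - 1 = real i" by simp
  ultimately show ?thesis
    unfolding increment_def telegraph_eq by (simp only: right_diff_distrib[symmetric])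
qed

lemma AE_increment_telegraph:
  assumes "d > 0"
  shows "AE \<omega> in M. \<forall>i. \<bar>increment (telegraph V0 N) d (Suc i) \<omega>\<bar> < v * d
    \<longleftrightarrow> N (real (Suc i) * d) \<omega> - N (real i * d) \<omega> \<noteq> 0"
  unfolding AE_all_countable
proof
  fix i
  let ?a = "real i * d" and ?b = "real (Suc i) * d"
  have ab: "0 \<le> ?a" "?a < ?b" "?b - ?a = d" using assms by (auto simp: algebra_simps)
  show "AE \<omega> in M. \<bar>increment (telegraph V0 N) d (Suc i) \<omega>\<bar> < v * d \<longleftrightarrow> N ?b \<omega> - N ?a \<omega> \<noteq> 0"
    using AE_abs_V0 AE_signed_count_changes[OF ab(1,2)] AE_space
  proof eventually_elim
    case (elim \<omega>)
    have abs: "\<bar>increment (telegraph V0 N) d (Suc i) \<omega>\<bar> = v * \<bar>integral {?a..?b} (\<lambda>s. signed_count s \<omega>)\<bar>"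
      using elim by (simp only: increment_telegraph[OF elim(3) assms] abs_mult)
    have "N ?a \<omega> \<le> N ?b \<omega>" using ab elim(3) by (intro mono_N) auto
    then consider "N ?b \<omega> = N ?a \<omega>" | "N ?b \<omega> \<noteq> N ?a \<omega>" "N ?b \<omega> - N ?a \<omega> \<noteq> 0" by linarith
    then show ?case
    proof cases
      case 1
      show ?thesis
        unfolding abs abs_integral_signed_count_eq[OF elim(3) ab(1,2) 1] ab(3) using 1 by simp
    next
      case 2
      then have "\<bar>integral {?a..?b} (\<lambda>s. signed_count s \<omega>)\<bar> < ?b - ?a"
        using abs_integral_signed_count_less[OF elim(3) ab(1)] elim(2) by blast
      then show ?thesis
        unfolding abs ab(3) using 2(2) v_pos by simp
    qed
  qed
qed

lemma measurable_lambda_hat: "lambda_hat v (telegraph V0 N) d n \<in> borel_measurable M"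
proof -
  note [measurable] = measurable_telegraph
  have "(\<lambda>\<omega>. if \<bar>increment (telegraph V0 N) d i \<omega>\<bar> < v * d then 1 else 0 :: real) \<in> borel_measurable M" for i
    unfolding increment_def by measurable
  then show ?thesis
    unfolding lambda_hat_def[abs_def] lambda_tilde_def by (simp add: indicator_def of_bool_def)
qed

definition zero_score_mean :: "real \<Rightarrow> nat \<Rightarrow> 'a \<Rightarrow> real" where
  "zero_score_mean d n \<omega> =
     (\<Sum>i<n. zero_score (rate * d) (N (real (Suc i) * d) \<omega> - N (real i * d) \<omega>)) / real n"

lemma AE_lambda_hat:
  assumes "d > 0" "n > 0"
  shows "AE \<omega> in M. zero_score_mean d n \<omega> < 1 \<longrightarrow>
    lambda_hat v (telegraph V0 N) d n \<omega> = rate - ln (1 - zero_score_mean d n \<omega>) / d"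
  using AE_increment_telegraph[OF assms(1)]
proof eventually_elim
  case (elim \<omega>)
  let ?D = "\<lambda>i. N (real (Suc i) * d) \<omega> - N (real i * d) \<omega>"
  let ?u = "zero_score_mean d n \<omega>"
  have "lambda_tilde v (telegraph V0 N) d n \<omega> = 1 / (real n * d) * (\<Sum>i<n. of_bool (?D i \<noteq> 0))"
    unfolding lambda_tilde_def using elim
    by (simp add: sum.atLeast1_atMost_eq indicator_def del: of_nat_Suc)
  also have "(\<Sum>i<n. of_bool (?D i \<noteq> 0) :: real) = (\<Sum>i<n. 1 - of_bool (?D i = 0))"
    by (intro sum.cong) auto
  finally have z: "1 - d * lambda_tilde v (telegraph V0 N) d n \<omega> = (\<Sum>i<n. of_bool (?D i = 0)) / real n"
    using assms by (simp add: sum_subtractf field_simps)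
  have "1 - ?u = exp (rate * d) * (1 - d * lambda_tilde v (telegraph V0 N) d n \<omega>)"
    unfolding z zero_score_mean_def zero_score_def using assms
    by (simp add: sum_subtractf sum_distrib_left field_simps)
  then have eq: "1 - d * lambda_tilde v (telegraph V0 N) d n \<omega> = exp (- (rate * d)) * (1 - ?u)"
    by (simp add: exp_minus)
  have "ln (exp (- (rate * d)) * (1 - ?u)) = - (rate * d) + ln (1 - ?u)" if "?u < 1"
    using that by (subst ln_mult) auto
  then show ?case
    unfolding lambda_hat_def eq using assms by (simp add: divide_simps)
qed

end

section \<open>Efficiency of the estimator\<close>

theorem theorem4p1:
  fixes M :: "'a measure" and rate v :: real
    and N :: "real \<Rightarrow> 'a \<Rightarrow> nat" and V0 :: "'a \<Rightarrow> real"
    and \<Delta> :: "nat \<Rightarrow> real"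
  assumes "telegraph_process M rate N v V0"
    and "\<And>n. n \<ge> 1 \<Longrightarrow> \<Delta> n > 0"
    and "\<Delta> \<longlonglongrightarrow> 0"
    and "filterlim (\<lambda>n. real n * \<Delta> n) at_top sequentially"
  shows "consistent_estimator M (\<lambda>n. lambda_hat v (telegraph V0 N) (\<Delta> n) n) rate \<and>
    asymptotically_normal M (\<lambda>n. real n * \<Delta> n)
      (\<lambda>n. lambda_hat v (telegraph V0 N) (\<Delta> n) n) rate rate \<and>
    asymptotically_normal M (\<lambda>n. real n * \<Delta> n)
      (\<lambda>n \<omega>. real (N (real n * \<Delta> n) \<omega>) / (real n * \<Delta> n)) rate rate"
proof -
  interpret telegraph_process M rate N v V0 by fact
  define T where "T n = real n * \<Delta> n" for n
  have \<Delta>: "\<Delta> n > 0" if "n > 0" for n using assms(2)[of n] that by simp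
  have T_nonneg: "0 \<le> T n" for n
    using \<Delta>[of n] by (cases "n = 0") (auto simp: T_def)
  have T_pos: "T n > 0" if "n > 0" for n using \<Delta>[OF that] that by (simp add: T_def)
  have T_top: "filterlim T at_top sequentially"
    using assms(4) by (simp add: T_def[abs_def])
  have \<mu>: "rate * \<Delta> n > 0" if "n > 0" for n using \<Delta>[OF that] rate_pos by simp
  define \<Lambda> where "\<Lambda> n = lambda_hat v (telegraph V0 N) (\<Delta> n) n" for n
  define U where "U n = zero_score_mean (\<Delta> n) n" for n
  define C where "C n \<omega> = real (N (T n) \<omega>) / T n" for n \<omega>
  note U_sq = has_bochner_integral_sum_increments_square[OF \<Delta> zero_score_moments(1,2)[OF \<mu>]]
  have [measurable]: "\<Lambda> n \<in> borel_measurable M" for n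
    unfolding \<Lambda>_def by (rule measurable_lambda_hat)
  have N_meas: "N (real i * \<Delta> n) \<in> measurable M (count_space UNIV)" if "n > 0" for i n
    using \<Delta>[OF that] by (intro measurable_N) simp
  have [measurable]: "U n \<in> borel_measurable M" for n
  proof (cases "n = 0")
    case False
    note [measurable] = N_meas[of n]
    from False show ?thesis unfolding U_def zero_score_mean_def by measurable
  qed (simp add: U_def zero_score_mean_def[abs_def])
  have [measurable]: "(\<lambda>\<omega>. real (N (T n) \<omega>)) \<in> borel_measurable M" for n
    using measurable_N[OF T_nonneg[of n]] by measurable
  then have [measurable]: "C n \<in> borel_measurable M" for n
    unfolding C_def by measurable

  have exp_lim: "(\<lambda>n. exp (rate * \<Delta> n) - 1) \<longlonglongrightarrow> 0"
    using tendsto_diff[OF tendsto_exp[OF tendsto_mult_left[OF assms(3), of rate]] tendsto_const[of 1]]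
    by simp
  have inv_T: "(\<lambda>n. inverse (T n)) \<longlonglongrightarrow> 0"
    by (rule tendsto_inverse_0_at_top[OF T_top])
  have inv_n: "(\<lambda>n. inverse (real n)) \<longlonglongrightarrow> 0"
    by (rule tendsto_inverse_0_at_top[OF filterlim_real_sequentially])
  have inv_sqrt_T: "(\<lambda>n. inverse (sqrt (T n))) \<longlonglongrightarrow> 0"
    by (rule tendsto_inverse_0_at_top[OF filterlim_compose[OF sqrt_at_top T_top]])

  have U_moment: "has_bochner_integral M (\<lambda>\<omega>. (U n \<omega>)\<^sup>2) ((exp (rate * \<Delta> n) - 1) * inverse (real n))" for n
  proof (cases "n = 0")
    case False
    then have "has_bochner_integral M (\<lambda>\<omega>. 1 / (real n)\<^sup>2 *
        (\<Sum>i<n. zero_score (rate * \<Delta> n) (N (real (Suc i) * \<Delta> n) \<omega> - N (real i * \<Delta> n) \<omega>))\<^sup>2)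
      (1 / (real n)\<^sup>2 * (real n * (exp (rate * \<Delta> n) - 1)))"
      by (intro has_bochner_integral_mult_right U_sq) auto
    also have "1 / (real n)\<^sup>2 * (real n * (exp (rate * \<Delta> n) - 1)) = (exp (rate * \<Delta> n) - 1) * inverse (real n)"
      by (simp add: power2_eq_square divide_simps)
    finally show ?thesis
      by (simp add: U_def zero_score_mean_def[abs_def] power_divide del: of_nat_Suc)
  qed (simp add: U_def zero_score_mean_def has_bochner_integral_zero)
  have U_conv: "consistent_estimator M U 0"
    using U_moment tendsto_mult[OF exp_lim inv_n] by (intro consistent_estimator_L2) auto

  define R where "R n \<omega> = sqrt (T n) * (U n \<omega>)\<^sup>2 / \<Delta> n" for n \<omega>
  have R_moment: "has_bochner_integral M (R n) ((exp (rate * \<Delta> n) - 1) * inverse (sqrt (T n)))" for n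
  proof -
    have "has_bochner_integral M (\<lambda>\<omega>. sqrt (T n) / \<Delta> n * (U n \<omega>)\<^sup>2)
       (sqrt (T n) / \<Delta> n * ((exp (rate * \<Delta> n) - 1) * inverse (real n)))"
      by (intro has_bochner_integral_mult_right U_moment)
    also have "sqrt (T n) / \<Delta> n * ((exp (rate * \<Delta> n) - 1) * inverse (real n))
      = (exp (rate * \<Delta> n) - 1) * (sqrt (T n) / T n)"
      by (simp add: T_def divide_inverse mult_ac)
    also have "sqrt (T n) / T n = inverse (sqrt (T n))"
      using T_nonneg by (simp add: sqrt_divide_self_eq)
    finally show ?thesis by (simp add: R_def[abs_def])
  qed
  have R_nonneg: "0 \<le> R n \<omega>" for n \<omega>
    using \<Delta>[of n] T_nonneg[of n] by (cases "n = 0") (auto simp: R_def T_def)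
  have R_conv: "consistent_estimator M R 0"
    using R_moment tendsto_mult[OF exp_lim inv_sqrt_T] R_nonneg
    by (intro consistent_estimator_L1) (auto simp: has_bochner_integral_iff)

  have centered: "C n \<omega> - rate = (\<Sum>i<n. real (N (real (Suc i) * \<Delta> n) \<omega> - N (real i * \<Delta> n) \<omega>) - rate * \<Delta> n) / T n"
    if "n > 0" "\<omega> \<in> space M" for n \<omega>
  proof -
    have "real n * (rate * \<Delta> n) / T n = rate" using that(1) \<Delta>[OF that(1)] by (simp add: T_def)
    then show ?thesis
      using count_eq_sum_increments[OF that(2) \<Delta>[OF that(1)], of n, folded T_def] T_pos[OF that(1)]
      by (simp add: C_def sum_subtractf diff_divide_distrib del: of_nat_Suc)
  qed

  define E where "E n \<omega> = sqrt (T n) * (U n \<omega> / \<Delta> n - (C n \<omega> - rate))" for n \<omega>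
  have E_moment: "has_bochner_integral M (\<lambda>\<omega>. (E n \<omega>)\<^sup>2) ((exp (rate * \<Delta> n) - 1 - rate * \<Delta> n) / \<Delta> n)" if n: "n > 0" for n
  proof -
    let ?D = "\<lambda>i \<omega>. N (real (Suc i) * \<Delta> n) \<omega> - N (real i * \<Delta> n) \<omega>"
    let ?f = "\<lambda>k. zero_score (rate * \<Delta> n) k - (real k - rate * \<Delta> n)"
    have "has_bochner_integral M (\<lambda>\<omega>. 1 / T n * (\<Sum>i<n. ?f (?D i \<omega>))\<^sup>2)
      (1 / T n * (real n * (exp (rate * \<Delta> n) - 1 - rate * \<Delta> n)))"
      using has_bochner_integral_diff[OF zero_score_moments(1,4)[OF \<mu>[OF n]]]
      by (intro has_bochner_integral_mult_right has_bochner_integral_sum_increments_square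
          zero_score_moments \<Delta> \<mu> n) auto
    moreover have "1 / T n * (\<Sum>i<n. ?f (?D i \<omega>))\<^sup>2 = (E n \<omega>)\<^sup>2" if "\<omega> \<in> space M" for \<omega>
    proof -
      have "U n \<omega> / \<Delta> n - (C n \<omega> - rate) = (\<Sum>i<n. ?f (?D i \<omega>)) / T n"
        unfolding centered[OF n that] U_def zero_score_mean_def T_def
        by (simp add: sum_subtractf diff_divide_distrib del: of_nat_Suc)
      then have "(E n \<omega>)\<^sup>2 = T n * ((\<Sum>i<n. ?f (?D i \<omega>)) / T n)\<^sup>2"
        using T_pos[OF n] by (simp add: E_def power_mult_distrib power_divide)
      then show ?thesis
        using T_pos[OF n] by (simp add: power_divide power2_eq_square[of "T n"])
    qed
    moreover have "1 / T n * (real n * (exp (rate * \<Delta> n) - 1 - rate * \<Delta> n))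
      = (exp (rate * \<Delta> n) - 1 - rate * \<Delta> n) / \<Delta> n"
      using n by (simp add: T_def)
    ultimately show ?thesis
      by (simp cong: has_bochner_integral_cong)
  qed
  have E_conv: "consistent_estimator M E 0"
  proof (rule consistent_estimator_L2)
    let ?s = "\<lambda>n. if n = 0 then 0 else (exp (rate * \<Delta> n) - 1 - rate * \<Delta> n) / \<Delta> n"
    show "has_bochner_integral M (\<lambda>\<omega>. (E n \<omega>)\<^sup>2) (?s n)" for n
      using E_moment[of n] by (cases "n = 0") (auto simp: E_def T_def has_bochner_integral_zero)
    show "?s \<longlonglongrightarrow> 0"
    proof (rule tendsto_sandwich[OF _ _ tendsto_const])
      have "\<forall>\<^sub>F n in sequentially. rate * \<Delta> n < 1"
        using tendsto_mult_left[OF assms(3), of rate] by (intro order_tendstoD) auto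
      then show "\<forall>\<^sub>F n in sequentially. ?s n \<le> rate\<^sup>2 * \<Delta> n"
        using eventually_gt_at_top[of 0]
      proof eventually_elim
        case (elim n)
        then have "exp (rate * \<Delta> n) - 1 - rate * \<Delta> n \<le> (rate * \<Delta> n)\<^sup>2"
          using \<mu>[of n] exp_bound[of "rate * \<Delta> n"] by simp
        with elim \<Delta>[of n] show ?case
          by (simp add: power2_eq_square divide_le_eq mult_ac)
      qed
      show "\<forall>\<^sub>F n in sequentially. 0 \<le> ?s n"
        using eventually_gt_at_top[of 0]
      proof eventually_elim
        case (elim n)
        moreover have "0 \<le> exp (rate * \<Delta> n) - 1 - rate * \<Delta> n"
          using exp_ge_add_one_self[of "rate * \<Delta> n"] by linarith
        ultimately show ?case using \<Delta>[of n] by simp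
      qed
      show "(\<lambda>n. rate\<^sup>2 * \<Delta> n) \<longlonglongrightarrow> 0"
        using tendsto_mult_left[OF assms(3), of "rate\<^sup>2"] by simp
    qed
  qed (simp add: E_def[abs_def])

  define F where "F n \<omega> = sqrt (T n) * (\<Lambda> n \<omega> - rate - U n \<omega> / \<Delta> n)" for n \<omega>
  have [measurable]: "E n \<in> borel_measurable M" "F n \<in> borel_measurable M" "R n \<in> borel_measurable M" for n
    by (simp_all add: E_def[abs_def] F_def[abs_def] R_def[abs_def])
  have F_le: "AE \<omega> in M. \<bar>U n \<omega>\<bar> \<le> 1 / 2 \<longrightarrow> \<bar>F n \<omega>\<bar> \<le> 2 * R n \<omega>" if n: "n > 0" for n
    using AE_lambda_hat[OF \<Delta>[OF n] n]
  proof eventually_elim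
    case (elim \<omega>)
    show ?case
    proof
      assume U: "\<bar>U n \<omega>\<bar> \<le> 1 / 2"
      then have "\<Lambda> n \<omega> - rate - U n \<omega> / \<Delta> n = - (ln (1 + - U n \<omega>) - - U n \<omega>) / \<Delta> n"
        using elim by (simp add: \<Lambda>_def U_def diff_divide_distrib)
      then have "\<bar>F n \<omega>\<bar> = sqrt (T n) * (\<bar>ln (1 + - U n \<omega>) - - U n \<omega>\<bar> / \<Delta> n)"
        using \<Delta>[OF n] T_nonneg[of n] by (simp add: F_def abs_mult abs_divide) linarith
      also have "\<dots> \<le> sqrt (T n) * (2 * (- U n \<omega>)\<^sup>2 / \<Delta> n)"
        using \<Delta>[OF n] T_nonneg[of n] U
        by (intro mult_left_mono divide_right_mono abs_ln_one_plus_x_minus_x_bound) auto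
      finally show "\<bar>F n \<omega>\<bar> \<le> 2 * R n \<omega>" by (simp add: R_def mult_ac)
    qed
  qed
  have F_conv: "consistent_estimator M F 0"
  proof (rule consistent_estimator_cover[OF _ _ U_conv R_conv])
    fix \<epsilon> :: real assume "\<epsilon> > 0"
    have "\<forall>\<^sub>F n in sequentially. AE \<omega> in M. \<epsilon> < \<bar>F n \<omega> - 0\<bar> \<longrightarrow> 1 / 2 < \<bar>U n \<omega>\<bar> \<or> \<epsilon> / 2 < \<bar>R n \<omega>\<bar>"
      using eventually_gt_at_top[of 0]
    proof eventually_elim
      case (elim n)
      show ?case using F_le[OF elim] by eventually_elim (use R_nonneg in auto)
    qed
    then show "\<exists>a>0. \<exists>b>0. \<forall>\<^sub>F n in sequentially.
        AE \<omega> in M. \<epsilon> < \<bar>F n \<omega> - 0\<bar> \<longrightarrow> a < \<bar>U n \<omega>\<bar> \<or> b < \<bar>R n \<omega>\<bar>"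
      using half_gt_zero[OF zero_less_one] half_gt_zero[OF \<open>\<epsilon> > 0\<close>] by blast
  qed auto

  define D where "D n \<omega> = sqrt (T n) * (\<Lambda> n \<omega> - rate) - sqrt (T n) * (C n \<omega> - rate)" for n \<omega>
  have D_eq: "D n \<omega> = E n \<omega> + F n \<omega>" for n \<omega>
    by (simp add: D_def E_def F_def algebra_simps)
  have D_conv: "consistent_estimator M D 0"
  proof (rule consistent_estimator_cover[OF _ _ E_conv F_conv])
    fix \<epsilon> :: real assume "\<epsilon> > 0"
    moreover have "\<epsilon> / 2 < \<bar>E n \<omega>\<bar> \<or> \<epsilon> / 2 < \<bar>F n \<omega>\<bar>" if "\<epsilon> < \<bar>D n \<omega> - 0\<bar>" for n \<omega>
      using that unfolding D_eq by linarith
    ultimately show "\<exists>a>0. \<exists>b>0. \<forall>\<^sub>F n in sequentially.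
        AE \<omega> in M. \<epsilon> < \<bar>D n \<omega> - 0\<bar> \<longrightarrow> a < \<bar>E n \<omega>\<bar> \<or> b < \<bar>F n \<omega>\<bar>"
      by (intro exI[of _ "\<epsilon> / 2"] conjI always_eventually) auto
  qed auto

  have normal_C: "asymptotically_normal M T C rate rate"
    unfolding C_def[abs_def] by (rule asymptotically_normal_count[OF T_nonneg T_top])
  have "real_distribution (density lborel (normal_density 0 (sqrt rate)))"
    using prob_space_normal_density[of "sqrt rate" 0] rate_pos
    by (auto simp: real_distribution_def real_distribution_axioms_def)
  from slutsky[OF _ _ this normal_C[unfolded asymptotically_normal_def] D_conv[unfolded D_def]]
  have normal_\<Lambda>: "asymptotically_normal M T \<Lambda> rate rate"
    unfolding asymptotically_normal_def by measurable

  define C' where "C' n \<omega> = (if n = 0 then 0 else C n \<omega> - rate)" for n \<omega>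
  have [measurable]: "C' n \<in> borel_measurable M" "D n \<in> borel_measurable M" for n
    by (simp_all add: C'_def[abs_def] D_def[abs_def])
  have C'_moment: "has_bochner_integral M (\<lambda>\<omega>. (C' n \<omega>)\<^sup>2) (rate * inverse (T n))" for n
  proof (cases "n = 0")
    case False
    then have n: "n > 0" by simp
    let ?D = "\<lambda>i \<omega>. N (real (Suc i) * \<Delta> n) \<omega> - N (real i * \<Delta> n) \<omega>"
    have "has_bochner_integral M (\<lambda>\<omega>. 1 / (T n)\<^sup>2 * (\<Sum>i<n. real (?D i \<omega>) - rate * \<Delta> n)\<^sup>2)
      (1 / (T n)\<^sup>2 * (real n * (rate * \<Delta> n)))"
      by (intro has_bochner_integral_mult_right
          has_bochner_integral_sum_increments_square[where h = "\<lambda>k. real k - rate * \<Delta> n"]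
          zero_score_moments \<Delta> \<mu> n)
    moreover have "1 / (T n)\<^sup>2 * (\<Sum>i<n. real (?D i \<omega>) - rate * \<Delta> n)\<^sup>2 = (C' n \<omega>)\<^sup>2" if "\<omega> \<in> space M" for \<omega>
      using centered[OF n that] n by (simp add: C'_def power_divide del: of_nat_Suc)
    moreover have "1 / (T n)\<^sup>2 * (real n * (rate * \<Delta> n)) = rate * inverse (T n)"
      using T_pos[OF n] by (simp add: T_def power2_eq_square field_simps)
    ultimately show ?thesis
      by (simp cong: has_bochner_integral_cong)
  qed (simp add: C'_def T_def has_bochner_integral_zero)
  have C'_conv: "consistent_estimator M C' 0"
    using C'_moment tendsto_mult_right_zero[OF inv_T, of rate] by (intro consistent_estimator_L2) auto
  have "consistent_estimator M \<Lambda> rate"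
  proof (rule consistent_estimator_cover[OF _ _ C'_conv D_conv])
    fix \<epsilon> :: real assume "\<epsilon> > 0"
    have "\<forall>\<^sub>F n in sequentially. 1 \<le> T n"
      using T_top by (simp add: filterlim_at_top)
    then have "\<forall>\<^sub>F n in sequentially.
        AE \<omega> in M. \<epsilon> < \<bar>\<Lambda> n \<omega> - rate\<bar> \<longrightarrow> \<epsilon> / 2 < \<bar>C' n \<omega>\<bar> \<or> \<epsilon> / 2 < \<bar>D n \<omega>\<bar>"
      using eventually_gt_at_top[of 0]
    proof eventually_elim
      case (elim n)
      show ?case
      proof (intro AE_I2 impI)
        fix \<omega> assume *: "\<epsilon> < \<bar>\<Lambda> n \<omega> - rate\<bar>"
        have "\<bar>D n \<omega>\<bar> = sqrt (T n) * \<bar>\<Lambda> n \<omega> - rate - C' n \<omega>\<bar>"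
          using elim T_nonneg[of n] by (simp add: D_def C'_def abs_mult flip: right_diff_distrib)
        then have "\<bar>\<Lambda> n \<omega> - rate - C' n \<omega>\<bar> \<le> \<bar>D n \<omega>\<bar>"
          using elim mult_right_mono[of 1 "sqrt (T n)" "\<bar>\<Lambda> n \<omega> - rate - C' n \<omega>\<bar>"] by simp
        with * show "\<epsilon> / 2 < \<bar>C' n \<omega>\<bar> \<or> \<epsilon> / 2 < \<bar>D n \<omega>\<bar>" by linarith
      qed
    qed
    then show "\<exists>a>0. \<exists>b>0. \<forall>\<^sub>F n in sequentially.
        AE \<omega> in M. \<epsilon> < \<bar>\<Lambda> n \<omega> - rate\<bar> \<longrightarrow> a < \<bar>C' n \<omega>\<bar> \<or> b < \<bar>D n \<omega>\<bar>"
      using half_gt_zero[OF \<open>\<epsilon> > 0\<close>] by blast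
  qed auto
  then show ?thesis
    using normal_\<Lambda> normal_C by (simp add: \<Lambda>_def[abs_def] C_def[abs_def] T_def[abs_def])
qed

end
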